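(* For each $s \geq 1$ and $n \geq 4$, we have $$R(\mathcal{P}_n^{2s,s},\mathcal{P}_4^{2s,s})=(n+1)s+1.$$
   Context: An $r$-uniform hypergraph $H=(V,E)$ consists of a vertex set $V$ and a collection $E$ of $r$-subsets of $V$; $K_N^r$ denotes the complete $r$-uniform hypergraph on $N$ vertices. For $r$-uniform hypergraphs $H_1,H_2$, the Ramsey number $R(H_1,H_2)$ is the minimum $N$ such that each red-blue coloring of the edges of $K_N^r$ contains either a red copy of $H_1$ or a blue copy of $H_2$. For integers $s,n\ge 1$, the path $\mathcal{P}_n^{2s,s}$ of length $n$ is the $2s$-uniform hypergraph on distinct vertices $v_1,v_2,\ldots,v_{(n+1)s}$ whose $n$ edges are $\{v_{1+is},\ldots,v_{(i+2)s}\}$ for $0\le i\le n-1$. Equivalently, it is given by pairwise disjoint $s$-sets $A_1,\ldots,A_{n+1}$ with edges $A_i\cup A_{i+1}$ for $1\le i\le n$. *)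

theory Defs
  imports Main "HOL-Library.Ramsey"
begin

record 'a hypergraph =
  vertices :: "'a set"
  edges :: "'a set set"

(* nsets A r, from HOL-Library.Ramsey, is the set of all r-element subsets of A *)
definition uniform_hypergraph :: "nat \<Rightarrow> 'a hypergraph \<Rightarrow> bool" where
  "uniform_hypergraph r H \<longleftrightarrow> edges H \<subseteq> nsets (vertices H) r"

definition complete_hypergraph :: "nat \<Rightarrow> nat \<Rightarrow> nat hypergraph" where
  "complete_hypergraph r N = \<lparr>vertices = {..<N}, edges = nsets {..<N} r\<rparr>"

(* Not necessarily induced copies: G may have further edges on the image of f. *)
definition contains_copy :: "'b hypergraph \<Rightarrow> 'a hypergraph \<Rightarrow> bool" where
  "contains_copy G H \<longleftrightarrow>
     (\<exists>f. inj_on f (vertices H) \<and> f ` vertices H \<subseteq> vertices G \<and>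
          (\<forall>e\<in>edges H. f ` e \<in> edges G))"

datatype colour = Red | Blue

(* A colouring is a total function on vertex sets; only its values on the edges of G matter. *)
definition colour_class :: "('a set \<Rightarrow> colour) \<Rightarrow> colour \<Rightarrow> 'a hypergraph \<Rightarrow> 'a hypergraph" where
  "colour_class c k G = \<lparr>vertices = vertices G, edges = {e \<in> edges G. c e = k}\<rparr>"

(* The uniformity r is passed explicitly; H1 and H2 are meant to be r-uniform. *)
definition ramsey_number :: "nat \<Rightarrow> 'a hypergraph \<Rightarrow> 'b hypergraph \<Rightarrow> nat" where
  "ramsey_number r H1 H2 =
     (LEAST N. \<forall>c. contains_copy (colour_class c Red (complete_hypergraph r N)) H1 \<or>
                   contains_copy (colour_class c Blue (complete_hypergraph r N)) H2)"

(* The path of length n (n edges) and uniformity 2s, with the vertex v_j represented by j. *)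
definition path_hypergraph :: "nat \<Rightarrow> nat \<Rightarrow> nat hypergraph" where
  "path_hypergraph s n =
     \<lparr>vertices = {1..(n + 1) * s}, edges = {{1 + i * s..(i + 2) * s} | i. i < n}\<rparr>"

lemma uniform_path_hypergraph: "uniform_hypergraph (2 * s) (path_hypergraph s n)"
proof -
  have "{1 + i * s..(i + 2) * s} \<in> nsets {1..(n + 1) * s} (2 * s)" if "i < n" for i
  proof -
    have "(i + 2) * s \<le> (n + 1) * s"
      using that by (intro mult_right_mono) auto
    then show ?thesis
      by (auto simp: nsets_def algebra_simps)
  qed
  then show ?thesis
    unfolding uniform_hypergraph_def path_hypergraph_def by auto
qed

end

theory Submission
  imports Defs
begin

text \<open>
  The lower bound colours an edge blue iff it contains a fixed vertex: a blue path of length 4 has two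
  disjoint edges, and a red path of length \<^term>\<open>n\<close> would have to use all vertices.

  For the upper bound, partition all but at least one vertex into \<^term>\<open>n + 1\<close> blocks of size
  \<^term>\<open>s\<close> and consider the induced 2-coloured complete graph on the blocks. It has neither a red
  Hamiltonian path nor a blue path on 5 vertices, which (for a suitable partition, and up to swapping
  the colours if \<^term>\<open>n = 4\<close>) forces one of two rigid patterns: a block joined in blue to all
  others, with at most one further blue edge, or, if \<^term>\<open>n = 5\<close>, a blue \<open>K\<^sub>4\<close> joined in red to the
  other two blocks. Exchanging a single vertex of a block with a spare vertex preserves the pattern.
  Finitely many such exchanges move the contents of any block into any other position of the pattern,
  so that an edge would have to change its colour.
\<close>

section \<open>Hamiltonian paths in graphs with at most one missing edge\<close>

text \<open>The pair \<open>a\<close>, \<open>b\<close> may coincide or lie outside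
  \<open>U\<close>, which covers the complete graph.\<close>

definition almost_complete :: "('v \<Rightarrow> 'v \<Rightarrow> bool) \<Rightarrow> 'v set \<Rightarrow> bool" where
  "almost_complete R U \<longleftrightarrow>
     (\<exists>a b. \<forall>x\<in>U. \<forall>y\<in>U. x \<noteq> y \<longrightarrow> \<not> R x y \<longrightarrow> {x, y} = {a, b})"

lemma successively_if_complete:
  assumes "distinct xs" and "\<And>x y. x \<in> set xs \<Longrightarrow> y \<in> set xs \<Longrightarrow> x \<noteq> y \<Longrightarrow> R x y"
  shows "successively R xs"
  using assms
proof (induction xs)
  case (Cons x xs)
  then show ?case
    by (cases xs) auto
qed simp

text \<open>Only the ends of a missing edge must be kept apart: one of them goes to the very end of
  the path, with other vertices in between.\<close>

lemma almost_complete_path_from: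
  assumes "finite U" and "card U \<ge> 4" and ac: "almost_complete R U" and "x \<in> U"
  shows "\<exists>xs. distinct (x # xs) \<and> set (x # xs) = U \<and> successively R (x # xs)"
proof -
  obtain a b where ab: "\<And>x y. x \<in> U \<Longrightarrow> y \<in> U \<Longrightarrow> x \<noteq> y \<Longrightarrow> \<not> R x y \<Longrightarrow> {x, y} = {a, b}"
    using ac unfolding almost_complete_def by blast
  have list_of_rest: "\<exists>ys. distinct ys \<and> set ys = U - S \<and> ys \<noteq> []" if "finite S" "card S \<le> 3" for S
  proof -
    obtain ys where "distinct ys" "set ys = U - S"
      using finite_distinct_list \<open>finite U\<close> by (metis finite_Diff)
    moreover have "\<not> U \<subseteq> S"
      using that assms(2) card_mono[of S U] by auto
    ultimately show ?thesis by (metis Diff_eq_empty_iff set_empty)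
  qed
  have card3: "card {p, q, r} \<le> 3" for p q r :: 'a
    by (simp add: card_insert_if)
  show ?thesis
  proof (cases "a \<in> U \<and> b \<in> U \<and> a \<noteq> b")
    case False
    then have complete: "R y z" if "y \<in> U" "z \<in> U" "y \<noteq> z" for y z
      using ab[OF that] that by (metis doubleton_eq_iff)
    obtain ys where "distinct ys" "set ys = U - {x}"
      using finite_distinct_list \<open>finite U\<close> by (metis finite_Diff)
    then have "distinct (x # ys)" "set (x # ys) = U"
      using \<open>x \<in> U\<close> by auto
    then show ?thesis
      using successively_if_complete[of "x # ys" R] complete by blast
  next
    case True
    \<comment> \<open>\<open>q\<close> is an end of the missing edge that differs from
      \<open>x\<close>, so it can be placed last.\<close>
    obtain p q where pq: "{p, q} = {a, b}" "p \<in> U" "q \<in> U" "p \<noteq> q" "x \<noteq> q"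
      using True by (cases "x = b") auto
    have R: "R y z" if "y \<in> U" "z \<in> U" "y \<noteq> z" "{y, z} \<noteq> {p, q}" for y z
      using ab[OF that(1-3)] that(4) pq(1) by blast
    \<comment> \<open>Four vertices leave at least one besides \<open>x\<close>, \<open>p\<close>,
      \<open>q\<close>; such vertices separate \<open>p\<close> from \<open>q\<close>.\<close>
    obtain ys where ys: "distinct ys" "set ys = U - {x, p, q}" "ys \<noteq> []"
      using list_of_rest[of "{x, p, q}"] card3 by auto
    have "successively R ys"
      using ys by (intro successively_if_complete R) auto
    moreover have "hd ys \<in> U - {x, p, q}" "last ys \<in> U - {x, p, q}"
      using ys by (metis hd_in_set) (use ys in \<open>metis last_in_set\<close>)
    ultimately have tail: "successively R (p # ys @ [q])"
      using ys(3) pq by (auto simp: successively_Cons successively_append_iff intro!: R)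
    show ?thesis
    proof (cases "x = p")
      case True
      then show ?thesis
        using tail ys pq by (intro exI[of _ "ys @ [q]"]) auto
    next
      case False
      then have "R x p"
        using pq \<open>x \<in> U\<close> by (intro R) auto
      then have "successively R (x # p # ys @ [q])"
        using tail by (simp add: successively_Cons)
      then show ?thesis
        using ys pq False \<open>x \<in> U\<close> by (intro exI[of _ "p # ys @ [q]"]) auto
    qed
  qed
qed

section \<open>Graphs without a red Hamiltonian path or a blue path on five vertices\<close>

text \<open>Here \<^term>\<open>R\<close> is the red graph on \<^term>\<open>W\<close> and its complement is the blue one.\<close>

locale ramsey_graph =
  fixes W :: "'v set" and R :: "'v \<Rightarrow> 'v \<Rightarrow> bool"
  assumes sym: "R x y \<longleftrightarrow> R y x"
    and no_red: "distinct xs \<Longrightarrow> set xs = W \<Longrightarrow> \<not> successively R xs"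
    and no_blue: "distinct [a, b, c, d, e] \<Longrightarrow> {a, b, c, d, e} \<subseteq> W \<Longrightarrow>
      \<not> R a b \<Longrightarrow> \<not> R b c \<Longrightarrow> \<not> R c d \<Longrightarrow> R d e"
begin

text \<open>Otherwise \<open>v\<close> would extend a red Hamiltonian path of \<open>U\<close>
  starting at \<open>x\<close> to one of \<open>W\<close>.\<close>

lemma centre_blue:
  assumes W: "W = insert v U" "v \<notin> U" and U: "finite U" "card U \<ge> 4" "almost_complete R U"
    and "x \<in> U"
  shows "\<not> R v x"
proof
  assume "R v x"
  obtain xs where "distinct (x # xs)" "set (x # xs) = U" "successively R (x # xs)"
    using almost_complete_path_from[OF U \<open>x \<in> U\<close>] by blast
  then have "distinct (v # x # xs)" "set (v # x # xs) = W" "successively R (v # x # xs)"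
    using W \<open>R v x\<close> by auto
  then show False
    using no_red by blast
qed

text \<open>Two blue edges inside \<open>U\<close> can be linked through \<open>v\<close> to a blue
  path on five vertices. The vertex \<open>w\<close> stands for a block that was just altered, so
  its colours are unknown; \<open>old\<close> is what survives of the earlier pattern.\<close>

lemma almost_complete_if_centre_blue:
  assumes W: "W = insert v U" "v \<notin> U" and U: "finite U" "card U \<ge> 4"
    and blue: "\<And>x. x \<in> U - {w} \<Longrightarrow> \<not> R v x"
    and old: "w \<in> U \<Longrightarrow> almost_complete R (U - {w})"
  shows "almost_complete R U"
proof (cases "\<exists>a\<in>U. \<exists>b\<in>U. a \<noteq> b \<and> \<not> R a b")
  case True
  then obtain a b where ab: "a \<in> U" "b \<in> U" "a \<noteq> b" "\<not> R a b" by blast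
  \<comment> \<open>A blue path \<open>p q r\<close> continues through \<open>v\<close> to some
    further \<open>z \<noteq> w\<close>, leaving from an end other than \<open>w\<close>. If there
    is no such \<open>z\<close>, counting puts \<open>w\<close> in \<open>U\<close> outside the
    path, and \<open>old\<close> forbids the two blue edges.\<close>
  have shared: False if pqr: "p \<in> U" "q \<in> U" "r \<in> U" "distinct [p, q, r]" "\<not> R p q" "\<not> R q r"
    for p q r
  proof -
    have "\<not> U - {w} \<subseteq> {p, q, r}"
    proof
      assume sub: "U - {w} \<subseteq> {p, q, r}"
      have "card {p, q, r} = 3" using pqr by simp
      show False
      proof (cases "w \<in> {p, q, r}")
        case True
        then have "U \<subseteq> {p, q, r}" using sub by auto
        then show False
          using card_mono[of "{p, q, r}" U] \<open>card {p, q, r} = 3\<close> U by simp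
      next
        case False
        then have "w \<in> U"
          using sub card_mono[of "{p, q, r}" U] \<open>card {p, q, r} = 3\<close> U by (cases "w \<in> U") auto
        then obtain c d where "\<And>x y. x \<in> U - {w} \<Longrightarrow> y \<in> U - {w} \<Longrightarrow> x \<noteq> y \<Longrightarrow> \<not> R x y \<Longrightarrow> {x, y} = {c, d}"
          using old unfolding almost_complete_def by blast
        from this[of p q] this[of q r] have "{p, q} = {q, r}" using pqr False by auto
        then show False using pqr by (auto simp: doubleton_eq_iff)
      qed
    qed
    then obtain z where z: "z \<in> U" "z \<noteq> w" "z \<notin> {p, q, r}" by auto
    show False
    proof (cases "w = r")
      case True
      then show False
        using no_blue[of r q p v z] pqr z blue[of p] blue[of z] W sym by auto
    next
      case False
      then show False
        using no_blue[of p q r v z] pqr z blue[of r] blue[of z] W sym by auto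
    qed
  qed
  have disjoint: False if xy: "x \<in> U" "y \<in> U" "x \<noteq> y" "\<not> R x y" "{x, y} \<inter> {a, b} = {}" for x y
  proof -
    \<comment> \<open>Both edges are oriented so that their ends next to \<open>v\<close> in the
      blue path \<open>a' b' v x' y'\<close> differ from \<open>w\<close>.\<close>
    obtain a' b' where a': "a' = a \<and> b' = b \<or> a' = b \<and> b' = a" "b' \<noteq> w" using ab by (cases "b = w") auto
    obtain x' y' where x': "x' = x \<and> y' = y \<or> x' = y \<and> y' = x" "x' \<noteq> w" using xy by (cases "x = w") auto
    have "\<not> R a' b'" "\<not> R x' y'"
      using a' x' ab xy sym by metis+
    moreover have "a' \<in> U" "b' \<in> U" "x' \<in> U" "y' \<in> U" "distinct [a', b', x', y']"
      using a' x' ab xy by auto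
    ultimately show False
      using no_blue[of a' b' v x' y'] blue[of b'] blue[of x'] a'(2) x'(2) W sym by auto
  qed
  have "{x, y} = {a, b}" if xy: "x \<in> U" "y \<in> U" "x \<noteq> y" "\<not> R x y" for x y
  proof (rule ccontr)
    assume ne: "{x, y} \<noteq> {a, b}"
    consider "x = a" | "x = b" | "y = a" | "y = b" | "{x, y} \<inter> {a, b} = {}" by auto
    then show False
    proof cases
      case 1 then show False using shared[of b a y] ab xy ne sym by auto
    next
      case 2 then show False using shared[of a b y] ab xy ne sym by auto
    next
      case 3 then show False using shared[of b a x] ab xy ne sym by auto
    next
      case 4 then show False using shared[of a b x] ab xy ne sym by auto
    next
      case 5 then show False using disjoint xy by blast
    qed
  qed
  then show ?thesis
    unfolding almost_complete_def by blast
qed (auto simp: almost_complete_def)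

text \<open>\<open>v\<close> is joined in blue to the ends of the red path. If \<open>v q\<close> is
  red, excluding red Hamiltonian paths makes \<open>v r\<close>, \<open>r p\<close> and
  \<open>p t\<close> blue, so \<open>q t\<close> must be red and \<open>q\<close> is a red centre;
  \<open>r\<close> is the mirror image.\<close>

lemma monochromatic_star_if_path:
  assumes W: "W = {v, p, q, r, t}" "distinct [v, p, q, r, t]" and path: "R p q" "R q r" "R r t"
  shows "(\<forall>x\<in>{p, q, r, t}. \<not> R v x) \<or> (\<forall>x\<in>{v, p, r, t}. R q x) \<or> (\<forall>x\<in>{v, p, q, t}. R r x)"
proof -
  have red: False if "distinct [a, b, c, d, e]" "{a, b, c, d, e} = W"
    "R a b" "R b c" "R c d" "R d e" for a b c d e
    using no_red[of "[a, b, c, d, e]"] that by auto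
  have ends: "\<not> R v p" "\<not> R v t"
    using red[of v p q r t] red[of p q r t v] W path sym by auto
  have nq: "R q t" if "R v q"
  proof -
    have "\<not> R p r" "\<not> R t p" "\<not> R v r"
      using red[of v q p r t] red[of v q r t p] red[of r t p q v] red[of p q v r t] that W path sym by auto
    then show ?thesis
      using no_blue[of v r p t q] no_blue[of r v p t q] ends W sym by auto
  qed
  have nr: "R r p" if "R v r"
  proof -
    have "\<not> R t q" "\<not> R t p" "\<not> R v q"
      using red[of v r t q p] red[of v r t p q] red[of p q v r t] red[of v r q p t] that W path sym by auto
    then show ?thesis
      using no_blue[of v q t p r] no_blue[of q v t p r] ends W sym by auto
  qed
  show ?thesis
    using ends nq nr path sym by auto
qed

text \<open>Rotations in the style of Posa: a red neighbour of \<open>v\<close> on the path forces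
  blue edges between path vertices, which combine to a blue path on five vertices unless there are
  just six vertices in all.\<close>

lemma extend_path:
  assumes W: "W = insert v (set p)" "v \<notin> set p" "distinct p"
    and p: "successively R p" and len: "length p \<ge> 5"
  shows "(\<forall>x\<in>set p. \<not> R v x) \<or>
    length p = 5 \<and> pairwise (\<lambda>x y. \<not> R x y) {v, p ! 0, p ! 2, p ! 4}"
proof -
  let ?n = "length p"
  have nth_distinct: "i < ?n \<Longrightarrow> j < ?n \<Longrightarrow> p ! i = p ! j \<longleftrightarrow> i = j" for i j
    using W(3) by (simp add: nth_eq_iff_index_eq)
  have nth_W: "i < ?n \<Longrightarrow> p ! i \<in> W \<and> p ! i \<noteq> v \<and> v \<noteq> p ! i" for i
    using W by (metis insertCI nth_mem)
  have first: "\<not> R v (p ! 0)"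
    using no_red[of "v # p"] W p len by (cases p) auto
  have last: "\<not> R v (p ! (?n - 1))"
    using no_red[of "p @ [v]"] W p len sym
    by (auto simp: successively_append_iff last_conv_nth)
  have insert_between: False if "p = as @ x # y # bs" "R v x" "R v y" for as x y bs
    using no_red[of "as @ x # v # y # bs"] p W that sym
    by (auto simp: successively_append_iff successively_Cons)
  \<comment> \<open>The red Hamiltonian path is \<open>v\<close>, \<open>x\<close>, the reversal of
    \<open>as\<close>, then \<open>bs\<close>; \<open>rotate_right'\<close> is its mirror
    image.\<close>
  have rotate_left': False if "p = as @ x # bs" "R v x" "R (hd as) (hd bs)" "as \<noteq> []" "bs \<noteq> []"
    for as x bs
    using no_red[of "v # x # rev as @ bs"] p W that sym
    by (auto simp: successively_append_iff successively_Cons hd_rev last_rev)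
  have rotate_right': False if "p = as @ x # bs" "R v x" "R (last bs) (last as)" "as \<noteq> []" "bs \<noteq> []"
    for as x bs
    using no_red[of "as @ rev bs @ [x, v]"] p W that sym
    by (auto simp: successively_append_iff successively_Cons hd_rev last_rev)
  have consec: "\<not> R v (p ! Suc i)" if i: "R v (p ! i)" "Suc i < ?n" for i
  proof
    assume r: "R v (p ! Suc i)"
    have "p = take i p @ p ! i # p ! Suc i # drop (Suc (Suc i)) p"
      using i by (simp add: Cons_nth_drop_Suc)
    then show False
      using insert_between i r by blast
  qed
  have rotate: "\<not> R (p ! 0) (p ! Suc i) \<and> \<not> R (p ! (?n - 1)) (p ! (i - 1))"
    if i: "R v (p ! i)" "0 < i" "Suc i < ?n" for i
  proof -
    define as bs where "as = take i p" and "bs = drop (Suc i) p"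
    have eq: "p = as @ p ! i # bs"
      unfolding as_def bs_def using i by (intro id_take_nth_drop) auto
    have ne: "as \<noteq> []" "bs \<noteq> []"
      using i by (auto simp: as_def bs_def)
    have "last bs = last p"
      using eq ne by (metis last_ConsR last_appendR list.discI)
    then have "last bs = p ! (?n - 1)"
      using i last_conv_nth[of p] by force
    moreover have "hd as = p ! 0" "hd bs = p ! Suc i" "last as = p ! (i - 1)"
      using ne i by (auto simp: as_def bs_def hd_conv_nth last_conv_nth)
    ultimately show ?thesis
      using rotate_left'[OF eq i(1) _ ne] rotate_right'[OF eq i(1) _ ne] by auto
  qed
  note rotate_left = rotate[THEN conjunct1] and rotate_right = rotate[THEN conjunct2]
  have blue: False if "distinct [i, j, k, l]" "i < ?n" "j < ?n" "k < ?n" "l < ?n"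
    "\<not> R v (p ! i)" "\<not> R v (p ! j)" "\<not> R (p ! j) (p ! k)"  "\<not> R (p ! k) (p ! l)" for i j k l
    using no_blue[of "p ! i" v "p ! j" "p ! k" "p ! l"] that nth_W nth_distinct sym W(1) by auto
  have blue': False if "distinct [i, j, k, l]" "i < ?n" "j < ?n" "k < ?n" "l < ?n"
    "\<not> R (p ! i) (p ! j)" "\<not> R v (p ! j)" "\<not> R v (p ! k)"  "\<not> R (p ! k) (p ! l)" for i j k l
    using no_blue[of "p ! i" "p ! j" v "p ! k" "p ! l"] that nth_W nth_distinct sym W(1) by auto
  show ?thesis
  proof (cases "\<exists>i<?n. R v (p ! i)")
    case False
    then show ?thesis by (metis in_set_conv_nth)
  next
    case True
    then obtain i where i: "i < ?n" "R v (p ! i)" by blast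
    have bounds: "0 < j \<and> Suc j < ?n" if "R v (p ! j)" "j < ?n" for j
      using that first last by (metis Suc_lessI diff_Suc_1 gr0I)
    have before: "\<not> R v (p ! (j - 1))" if "R v (p ! j)" "j < ?n" for j
      using consec[of "j - 1"] bounds[OF that] that by auto
    have after: "\<not> R v (p ! Suc j)" if "R v (p ! j)" "j < ?n" for j
      using consec bounds that by auto
    \<comment> \<open>At any other position, \<open>p ! 0\<close>, \<open>p ! Suc j\<close>,
      \<open>v\<close>, \<open>p ! (j - 1)\<close>, \<open>p ! (?n - 1)\<close> are five distinct
      vertices of a blue path.\<close>
    have ends: "j = 1 \<or> j = ?n - 2" if j: "R v (p ! j)" "j < ?n" for j
    proof (rule ccontr)
      assume "\<not> (j = 1 \<or> j = ?n - 2)"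
      then have "distinct [0, Suc j, j - 1, ?n - 1]" "0 < ?n" "j - 1 < ?n"
        using bounds[OF j] by auto
      then show False
        using blue'[of 0 "Suc j" "j - 1" "?n - 1"] j bounds[OF j] before[OF j] after[OF j]
          rotate_left[of j] rotate_right[of j] sym by auto
    qed
    have right: "?n = 5 \<and> R v (p ! 1)" if j: "R v (p ! (?n - 2))"
    proof -
      have r: "\<not> R (p ! 0) (p ! (?n - 1))" "\<not> R (p ! (?n - 1)) (p ! (?n - 3))"
        using rotate_left[OF j] rotate_right[OF j] len by (auto simp: eval_nat_numeral Suc_diff_Suc)
      \<comment> \<open>Otherwise \<open>p ! k\<close>, \<open>v\<close>, \<open>p ! 0\<close>,
        \<open>p ! (?n - 1)\<close>, \<open>p ! (?n - 3)\<close> is a blue path. If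
        \<open>?n \<ge> 6\<close>, this makes the consecutive vertices at positions 1 and 2 red
        neighbours of \<open>v\<close>.\<close>
      have *: "R v (p ! k)" if "k < ?n - 3" "0 < k" for k
      proof -
        have "distinct [k, 0, ?n - 1, ?n - 3]" "k < ?n" "0 < ?n" "?n - 1 < ?n" "?n - 3 < ?n"
          using that len by auto
        then show ?thesis using blue[of k 0 "?n - 1" "?n - 3"] r first by blast
      qed
      have "?n = 5"
      proof (rule ccontr)
        assume "?n \<noteq> 5"
        then have "R v (p ! 1)" "R v (p ! Suc 1)" "Suc 1 < ?n"
          using *[of 1] *[of "Suc 1"] len by auto
        then show False using consec by blast
      qed
      then show ?thesis using *[of 1] by auto
    qed
    have left: "?n = 5 \<and> R v (p ! 3)" if j: "R v (p ! 1)"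
    proof -
      have r: "\<not> R (p ! 0) (p ! 2)" "\<not> R (p ! (?n - 1)) (p ! 0)"
        using rotate_left[OF j] rotate_right[OF j] len by (auto simp: eval_nat_numeral Suc_diff_Suc)
      \<comment> \<open>The mirror image, with the blue path \<open>p ! k\<close>, \<open>v\<close>,
        \<open>p ! (?n - 1)\<close>, \<open>p ! 0\<close>, \<open>p ! 2\<close> and positions 3 and
        4.\<close>
      have *: "R v (p ! k)" if "k < ?n - 1" "2 < k" for k
      proof -
        have "distinct [k, ?n - 1, 0, 2]" "k < ?n" "0 < ?n" "?n - 1 < ?n" "2 < ?n"
          using that len by auto
        then show ?thesis using blue[of k "?n - 1" 0 2] r last by blast
      qed
      have "?n = 5"
      proof (rule ccontr)
        assume "?n \<noteq> 5"
        then have "R v (p ! 3)" "R v (p ! Suc 3)" "Suc 3 < ?n"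
          using *[of 3] *[of "Suc 3"] len by auto
        then show False using consec by blast
      qed
      then show ?thesis using *[of 3] by auto
    qed
    have *: "?n = 5 \<and> R v (p ! 1) \<and> R v (p ! 3)"
    proof -
      consider "R v (p ! 1)" | "R v (p ! (?n - 2))"
        using ends[OF i(2,1)] i(2) by blast
      then show ?thesis
      proof cases
        case 1
        with left show ?thesis by blast
      next
        case 2
        then have "?n = 5" "R v (p ! 1)" using right by blast+
        moreover from this have "R v (p ! 3)" using left by blast
        ultimately show ?thesis by blast
      qed
    qed
    \<comment> \<open>Together with \<open>first\<close>, these are all six edges of the blue
      clique.\<close>
    have "\<not> R (p ! 0) (p ! 2)" "\<not> R (p ! 0) (p ! 4)" "\<not> R (p ! 4) (p ! 2)" "\<not> R v (p ! 2)"
      "\<not> R v (p ! 4)"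
      using rotate_left[of 1] rotate_left[of 3] rotate_right[of 3] after[of 1] after[of 3] *
      by (auto simp: eval_nat_numeral)
    then show ?thesis
      using * first sym by (auto simp: pairwise_def)
  qed
qed

end

lemma almost_complete_cong_subset:
  assumes "almost_complete R U" and "U' \<subseteq> U"
    and "\<And>x y. x \<in> U' \<Longrightarrow> y \<in> U' \<Longrightarrow> R' x y = R x y"
  shows "almost_complete R' U'"
  using assms unfolding almost_complete_def by (metis subsetD)

text \<open>A blue edge from \<open>x\<close> to \<open>a\<close> would continue through the other
  three clique vertices.\<close>

lemma (in ramsey_graph) red_to_blue_K4:
  assumes "U \<subseteq> W" "card U = 4" "pairwise (\<lambda>x y. \<not> R x y) U" "x \<in> W - U" "a \<in> U"
  shows "R x a"
proof -
  have "card (U - {a}) = 3" using assms by (simp add: card_Diff_singleton)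
  then obtain b c d where "U - {a} = {b, c, d}" "distinct [b, c, d]"
    by (auto simp: card_3_iff)
  then have U: "U = {a, b, c, d}" "distinct [a, b, c, d]" using \<open>a \<in> U\<close> by auto
  then show ?thesis
    using no_blue[of x a b c d] assms by (auto simp: pairwise_def)
qed

text \<open>For use after block \<open>l\<close> of the clique was altered. A red edge from
  \<open>l\<close> to \<open>a\<close> would start the red Hamiltonian path
  \<open>l, a, x, b, y, c\<close>, with \<open>b\<close>, \<open>c\<close> the remaining clique
  vertices.\<close>

lemma (in ramsey_graph) blue_K4_restore:
  assumes W: "W = insert x (insert y U)" "x \<notin> U" "y \<notin> U" "x \<noteq> y"
    and U: "card U = 4" "l \<in> U"
    and blue: "pairwise (\<lambda>i j. \<not> R i j) (U - {l})"
    and red: "\<And>i. i \<in> U - {l} \<Longrightarrow> R x i \<and> R y i"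
  shows "pairwise (\<lambda>i j. \<not> R i j) U"
proof -
  have "\<not> R l a" if a: "a \<in> U - {l}" for a
  proof
    assume "R l a"
    have "card (U - {l} - {a}) = 2" using U a by (simp add: card_Diff_singleton)
    then obtain b c where "U - {l} - {a} = {b, c}" "b \<noteq> c"
      by (auto simp: card_2_iff)
    then have U': "U = {l, a, b, c}" "distinct [l, a, b, c]" using a U by auto
    then have "distinct [l, a, x, b, y, c]" "set [l, a, x, b, y, c] = W"
      using W by auto
    moreover have "R a x" "R x b" "R b y" "R y c"
      using red[of a] red[of b] red[of c] U' sym by auto
    ultimately show False
      using no_red \<open>R l a\<close> by fastforce
  qed
  then have "\<not> R i j" if "i \<in> U" "j \<in> U" "i \<noteq> j" for i j
    using that pairwiseD[OF blue, of i j] sym by (metis Diff_iff singletonD)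
  then show ?thesis
    by (simp add: pairwise_def)
qed

text \<open>Either an end of the red path \<open>p q r\<close> has a red edge to \<open>u\<close> or
  \<open>w\<close>, giving a red path on four vertices, or \<open>u p w r\<close> is a blue one. The
  hypotheses are symmetric in the colours, so \<open>monochromatic_star_if_path\<close> applies to
  both.\<close>

lemma ramsey_graph_P3_star:
  assumes "ramsey_graph W R" "ramsey_graph W (\<lambda>x y. \<not> R x y)"
    and W: "W = {p, q, r, u, w}" "distinct [p, q, r, u, w]" and path: "R p q" "R q r"
  shows "\<exists>k\<in>W. (\<forall>x\<in>W - {k}. R k x) \<or> (\<forall>x\<in>W - {k}. \<not> R k x)"
proof -
  interpret red: ramsey_graph W R by fact
  interpret blue: ramsey_graph W "\<lambda>x y. \<not> R x y" by fact
  note sym = red.sym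
  have star: ?thesis if eq: "W = {v, a, b, c, d}" "distinct [v, a, b, c, d]"
    "(\<forall>x\<in>{a, b, c, d}. S v x) \<or> (\<forall>x\<in>{v, a, c, d}. T b x) \<or> (\<forall>x\<in>{v, a, b, d}. T c x)"
    "S = R \<and> T = (\<lambda>x y. \<not> R x y) \<or> T = R \<and> S = (\<lambda>x y. \<not> R x y)" for v a b c d S T
  proof -
    have "W - {v} = {a, b, c, d}" "W - {b} = {v, a, c, d}" "W - {c} = {v, a, b, d}"
      unfolding eq using that(2) by auto
    then have "\<exists>k\<in>{v, b, c}. (\<forall>x\<in>W - {k}. S k x) \<or> (\<forall>x\<in>W - {k}. T k x)"
      using that(3) by fastforce
    then have "\<exists>k\<in>W. (\<forall>x\<in>W - {k}. S k x) \<or> (\<forall>x\<in>W - {k}. T k x)"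
      unfolding eq by blast
    then show ?thesis
      using that(4) by blast
  qed
  have red4: ?thesis if "W = {v, a, b, c, d}" "distinct [v, a, b, c, d]" "R a b" "R b c" "R c d"
    for v a b c d
    using star[OF that(1,2), of "\<lambda>x y. \<not> R x y" R] red.monochromatic_star_if_path[OF that] by blast
  have blue4: ?thesis if "W = {v, a, b, c, d}" "distinct [v, a, b, c, d]" "\<not> R a b" "\<not> R b c" "\<not> R c d"
    for v a b c d
    using star[OF that(1,2), of R "\<lambda>x y. \<not> R x y"] blue.monochromatic_star_if_path[OF that] by blast
  consider "R p u" | "R p w" | "R r u" | "R r w" | "\<not> R p u" "\<not> R p w" "\<not> R r u" "\<not> R r w"
    by blast
  then show ?thesis
  proof cases
    case 1 then show ?thesis using W path sym by (intro red4[of w u p q r]) auto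
  next
    case 2 then show ?thesis using W path sym by (intro red4[of u w p q r]) auto
  next
    case 3 then show ?thesis using W path sym by (intro red4[of w p q r u]) auto
  next
    case 4 then show ?thesis using W path sym by (intro red4[of u p q r w]) auto
  next
    case 5 then show ?thesis using W path sym by (intro blue4[of q u p w r]) auto
  qed
qed

text \<open>Two edges of any triangle share a colour, and they form a path on three
  vertices.\<close>

lemma ramsey_graph_monochromatic_star:
  assumes R: "ramsey_graph W R" "ramsey_graph W (\<lambda>x y. \<not> R x y)" and "card W = 5"
  shows "\<exists>k\<in>W. (\<forall>x\<in>W - {k}. R k x) \<or> (\<forall>x\<in>W - {k}. \<not> R k x)"
proof -
  have "\<exists>xs. distinct xs \<and> set xs = W"
    using \<open>card W = 5\<close> by (metis card.infinite finite_distinct_list zero_neq_numeral)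
  then obtain xs where xs: "distinct xs" "set xs = W" by blast
  then have "length xs = 5" using \<open>card W = 5\<close> distinct_card by metis
  then obtain p q r u w where "xs = [p, q, r, u, w]"
    by (auto simp: eval_nat_numeral length_Suc_conv)
  with xs have W: "W = {p, q, r, u, w}" "distinct [p, q, r, u, w]" by auto
  have red: ?thesis if "W = {a, b, c, u, w}" "distinct [a, b, c, u, w]" "R a b" "R b c" for a b c
    using ramsey_graph_P3_star[OF R that] .
  have blue: ?thesis if "W = {a, b, c, u, w}" "distinct [a, b, c, u, w]" "\<not> R a b" "\<not> R b c" for a b c
  proof -
    have "ramsey_graph W (\<lambda>x y. \<not> \<not> R x y)" using R(1) by simp
    from ramsey_graph_P3_star[OF R(2) this that] show ?thesis by blast
  qed
  have eq: "W = {q, r, p, u, w}" "W = {r, p, q, u, w}" using W by auto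
  consider "R p q" "R q r" | "\<not> R p q" "\<not> R q r" | "R q r" "R r p" | "\<not> R q r" "\<not> R r p"
    | "R r p" "R p q" | "\<not> R r p" "\<not> R p q"
    by blast
  then show ?thesis
  proof cases
    case 1 then show ?thesis using red[OF W] by blast
  next
    case 2 then show ?thesis using blue[OF W] by blast
  next
    case 3 then show ?thesis using red[OF eq(1)] W(2) by auto
  next
    case 4 then show ?thesis using blue[OF eq(1)] W(2) by auto
  next
    case 5 then show ?thesis using red[OF eq(2)] W(2) by auto
  next
    case 6 then show ?thesis using blue[OF eq(2)] W(2) by auto
  qed
qed

section \<open>Families of disjoint blocks and exchanges of single vertices\<close>

text \<open>These are the \<open>m + 1\<close> sets \<open>A_1, ..., A_(m+1)\<close> of a path of
  length \<open>m\<close>, with indices starting at 0.\<close>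

definition blocks :: "'a set \<Rightarrow> nat \<Rightarrow> nat \<Rightarrow> (nat \<Rightarrow> 'a set) \<Rightarrow> bool" where
  "blocks V s m F \<longleftrightarrow>
     (\<forall>i\<le>m. F i \<subseteq> V \<and> card (F i) = s) \<and> (\<forall>i\<le>m. \<forall>j\<le>m. i \<noteq> j \<longrightarrow> F i \<inter> F j = {})"

text \<open>Turns a path in the graph on the blocks into a family ordered along that path.\<close>

lemma blocks_nth:
  assumes "blocks V s n F" "distinct xs" "set xs \<subseteq> {..n}" "length xs = Suc m"
  shows "blocks V s m (\<lambda>i. F (xs ! i))"
proof -
  have "xs ! i \<le> n" if "i \<le> m" for i
    using assms that by (metis atMost_iff le_imp_less_Suc nth_mem subsetD)
  moreover have "xs ! i \<noteq> xs ! j" if "i \<le> m" "j \<le> m" "i \<noteq> j" for i j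
    using assms that by (simp add: nth_eq_iff_index_eq)
  ultimately show ?thesis
    using assms(1) unfolding blocks_def by simp
qed

lemma card_UN_blocks:
  assumes "blocks V s m F" "finite V"
  shows "card (\<Union>i\<le>m. F i) = (m + 1) * s"
proof -
  have "finite (F i)" if "i \<le> m" for i
    using assms that unfolding blocks_def by (meson finite_subset)
  then have "card (\<Union>i\<le>m. F i) = (\<Sum>i\<le>m. card (F i))"
    using assms unfolding blocks_def by (intro card_UN_disjoint) auto
  also have "\<dots> = (m + 1) * s"
    using assms unfolding blocks_def by simp
  finally show ?thesis .
qed

lemma blocks_extend:
  assumes F: "blocks V s m F" and V: "finite V" "card V \<ge> (m + 2) * s"
  obtains B where "blocks V s (Suc m) (F(Suc m := B))"
proof -
  let ?U = "\<Union>i\<le>m. F i"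
  have "?U \<subseteq> V" using F unfolding blocks_def by auto
  then have "card (V - ?U) = card V - (m + 1) * s"
    using card_UN_blocks[OF F V(1)] V(1) by (simp add: card_Diff_subset finite_subset)
  then have "s \<le> card (V - ?U)" using V(2) by (simp add: algebra_simps)
  then obtain B where "B \<subseteq> V - ?U" "card B = s" by (meson obtain_subset_with_card_n)
  then have "blocks V s (Suc m) (F(Suc m := B))"
    using F unfolding blocks_def by (auto simp: le_Suc_eq)
  then show ?thesis using that by blast
qed

lemma blocks_exist:
  assumes "finite V" "card V \<ge> (m + 1) * s"
  shows "\<exists>F. blocks V s m F"
  using assms(2)
proof (induction m)
  case 0
  then obtain B where "B \<subseteq> V" "card B = s" by (metis add_0 mult_1 obtain_subset_with_card_n)
  then have "blocks V s 0 (\<lambda>_. B)" unfolding blocks_def by simp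
  then show ?case by blast
next
  case (Suc m)
  then obtain F where "blocks V s m F" by auto
  then show ?case
    using blocks_extend[of V s m F] Suc.prems assms(1) by (metis Suc_eq_plus1 add_2_eq_Suc')
qed

lemma blocks_replace:
  assumes F: "blocks V s n F" and "finite V" and "k \<le> n" "a \<in> F k" "u \<in> V - (\<Union>i\<le>n. F i)"
  shows "blocks V s n (F(k := insert u (F k - {a})))"
proof -
  have "finite (F k)" using F \<open>finite V\<close> \<open>k \<le> n\<close> unfolding blocks_def by (meson finite_subset)
  then have card: "card (insert u (F k - {a})) = card (F k)"
    using assms card_Suc_Diff1[of "F k" a] by auto
  have F': "F i \<subseteq> V" "card (F i) = s" "u \<notin> F i" if "i \<le> n" for i
    using F that \<open>u \<in> V - _\<close> unfolding blocks_def by auto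
  have disj: "F i \<inter> F j = {}" if "i \<le> n" "j \<le> n" "i \<noteq> j" for i j
    using F that unfolding blocks_def by blast
  let ?F = "F(k := insert u (F k - {a}))"
  have "?F i \<subseteq> V" "card (?F i) = s" if "i \<le> n" for i
    using F'[OF that] F'[of k] card \<open>k \<le> n\<close> \<open>u \<in> V - _\<close> by auto
  moreover have "?F i \<inter> ?F j = {}" if "i \<le> n" "j \<le> n" "i \<noteq> j" for i j
    using disj[OF that] F'(3)[OF that(1)] F'(3)[OF that(2)] that(3) by auto
  ultimately show ?thesis
    unfolding blocks_def by blast
qed

text \<open>Vertices outside all blocks act as the blank of a sliding puzzle: exchanging single
  vertices with the blank moves the contents \<^term>\<open>T\<close> of one block into another one.\<close>

lemma sliding_blocks:
  assumes V: "finite V" "card V \<ge> (n + 1) * s + 1"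
    and blocks: "\<And>F. Q F \<Longrightarrow> blocks V s n F"
    and step: "\<And>F k a u. Q F \<Longrightarrow> k \<le> n \<Longrightarrow> a \<in> F k \<Longrightarrow> u \<in> V - (\<Union>i\<le>n. F i) \<Longrightarrow>
      Q (F(k := insert u (F k - {a})))"
    and CD: "C \<le> n" "D \<le> n" "C \<noteq> D"
    and T: "T \<subseteq> V" "card T = s"
    and "Q F" and "\<And>j. j \<le> n \<Longrightarrow> j \<noteq> C \<Longrightarrow> j \<noteq> D \<Longrightarrow> F j \<inter> T = {}"
  shows "\<exists>G. Q G \<and> G C = T \<and> (\<forall>j. j \<noteq> C \<longrightarrow> j \<noteq> D \<longrightarrow> G j = F j)"
  using assms(10-)
proof (induction "card (T - F C)" arbitrary: F rule: less_induct)
  case less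
  note F = blocks[OF \<open>Q F\<close>]
  have fin: "finite T" "finite (F C)" and card: "card (F C) = s"
    using F V T CD unfolding blocks_def by (auto intro: finite_subset)
  show ?case
  proof (cases "T = F C")
    case True
    then show ?thesis using less.prems by blast
  next
    case False
    obtain t where t: "t \<in> T" "t \<notin> F C"
      using False card T fin card_subset_eq[of "F C" T] by blast
    obtain a where a: "a \<in> F C" "a \<notin> T"
      using False card T fin card_subset_eq[of T "F C"] by force
    \<comment> \<open>Once \<open>t\<close> lies in no block, it is exchanged with \<open>a\<close>
      in block \<open>C\<close>, which brings one more element of \<open>T\<close> there and
      decreases the measure.\<close>
    have move: ?thesis
      if F': "Q F'" "F' C = F C" "t \<notin> (\<Union>i\<le>n. F' i)" "\<And>j. j \<noteq> C \<Longrightarrow> j \<noteq> D \<Longrightarrow> F' j = F j" for F'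
    proof -
      let ?F = "F'(C := insert t (F C - {a}))"
      have "Q ?F" using step[of F' C a t] F' a t T CD by auto
      moreover have "card (T - ?F C) < card (T - F C)"
        using t a fin by (intro psubset_card_mono) auto
      moreover have "?F j \<inter> T = {}" if "j \<le> n" "j \<noteq> C" "j \<noteq> D" for j
        using less.prems(2) F'(4) that by simp
      ultimately have "\<exists>G. Q G \<and> G C = T \<and> (\<forall>j. j \<noteq> C \<longrightarrow> j \<noteq> D \<longrightarrow> G j = ?F j)"
        using less.hyps[of ?F] by blast
      then show ?thesis using F' by auto
    qed
    show ?thesis
    proof (cases "t \<in> (\<Union>i\<le>n. F i)")
      case False
      then show ?thesis using move[of F] less.prems by blast
    next
      case True
      then have "t \<in> F D" using less.prems(2) t by blast
      have sub: "(\<Union>i\<le>n. F i) \<subseteq> V" using F unfolding blocks_def by auto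
      have "(\<Union>i\<le>n. F i) \<noteq> V" using card_UN_blocks[OF F V(1)] V(2) by auto
      \<comment> \<open>\<open>t\<close> sits in block \<open>D\<close>; the spare vertex
        \<open>u\<close>, which exists by the extra 1 in the size of \<open>V\<close>, takes its
        place and sets it free.\<close>
      then obtain u where u: "u \<in> V - (\<Union>i\<le>n. F i)" using sub by blast
      have "t \<notin> F i" if "i \<le> n" "i \<noteq> D" for i
        using F \<open>t \<in> F D\<close> that CD unfolding blocks_def by blast
      moreover have "t \<noteq> u"
        using u \<open>t \<in> F D\<close> CD by blast
      ultimately show ?thesis
        using move[of "F(D := insert u (F D - {t}))"] step[of F D t u] less.prems CD u \<open>t \<in> F D\<close>
        by (auto split: if_splits)
    qed
  qed
qed

section \<open>Excluding the rigid patterns by sliding blocks\<close>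

text \<open>The colouring to be refuted, where \<open>R e\<close> means that \<open>e\<close> is
  red.\<close>

locale ramsey_free =
  fixes s n :: nat and V :: "'a set" and R :: "'a set \<Rightarrow> bool"
  assumes fin: "finite V" and card_V: "card V \<ge> (n + 1) * s + 1" and n4: "n \<ge> 4"
    and no_red_path: "blocks V s n F \<Longrightarrow> \<exists>i<n. \<not> R (F i \<union> F (Suc i))"
    and no_blue_path: "blocks V s 4 F \<Longrightarrow> \<exists>i<4. R (F i \<union> F (Suc i))"
begin

abbreviation rel :: "(nat \<Rightarrow> 'a set) \<Rightarrow> nat \<Rightarrow> nat \<Rightarrow> bool" where
  "rel F i j \<equiv> R (F i \<union> F j)"

lemma graph:
  assumes F: "blocks V s n F"
  shows "ramsey_graph {..n} (rel F)"
proof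
  show "rel F i j \<longleftrightarrow> rel F j i" for i j
    by (simp add: Un_commute)
next
  fix xs assume xs: "distinct xs" "set xs = {..n}"
  then have len: "length xs = Suc n" using distinct_card[of xs] by simp
  show "\<not> successively (rel F) xs"
    using no_red_path[OF blocks_nth[OF F xs(1) _ len]] xs(2) len
    by (auto simp: successively_conv_nth)
next
  fix a b c d e :: nat
  assume "distinct [a, b, c, d, e]" "{a, b, c, d, e} \<subseteq> {..n}"
    and *: "\<not> rel F a b" "\<not> rel F b c" "\<not> rel F c d"
  then have "blocks V s 4 (\<lambda>i. F ([a, b, c, d, e] ! i))"
    by (intro blocks_nth[OF F]) auto
  from no_blue_path[OF this] * show "rel F d e"
    by (auto simp: less_Suc_eq eval_nat_numeral)
qed

text \<open>Every exchange preserves the pattern \<open>Q\<close>, in which block \<open>k\<close>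
  is joined in blue to all others. Sliding the contents of \<open>d\<close> into position
  \<open>k\<close>, while some block joined in red to \<open>d\<close> stays put, makes a red edge
  blue.\<close>

lemma no_almost_complete:
  assumes F: "blocks V s n F" and ac: "almost_complete (rel F) ({..n} - {k})" and "k \<le> n"
  shows False
proof -
  let ?U = "{..n} - {k}"
  define Q where "Q F \<longleftrightarrow> blocks V s n F \<and> almost_complete (rel F) ?U" for F
  have U: "{..n} = insert k ?U" "k \<notin> ?U" "finite ?U" "card ?U \<ge> 4"
    using \<open>k \<le> n\<close> n4 by auto
  have centre: "\<not> rel F k x" if "Q F" "x \<in> ?U" for F x
  proof -
    have F: "blocks V s n F" and ac: "almost_complete (rel F) ?U"
      using \<open>Q F\<close> unfolding Q_def by (rule conjunct1, rule conjunct2)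
    show ?thesis
      by (rule ramsey_graph.centre_blue[OF graph[OF F] U ac \<open>x \<in> ?U\<close>])
  qed
  have step: "Q (F(l := insert u (F l - {a})))"
    if "Q F" "l \<le> n" "a \<in> F l" "u \<in> V - (\<Union>i\<le>n. F i)" for F l a u
  proof -
    let ?F = "F(l := insert u (F l - {a}))"
    have F: "blocks V s n F" and ac: "almost_complete (rel F) ?U"
      using \<open>Q F\<close> unfolding Q_def by (rule conjunct1, rule conjunct2)
    note F' = blocks_replace[OF F fin that(2-4)]
    have "almost_complete (rel ?F) ?U"
    \<comment> \<open>Altering block \<open>k\<close> leaves the graph on the rest untouched;
      otherwise \<open>l\<close> is the exceptional vertex \<open>w\<close> of
      \<open>almost_complete_if_centre_blue\<close>.\<close>
    proof (cases "l = k")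
      case True
      show ?thesis by (rule almost_complete_cong_subset[OF ac]) (use True in auto)
    next
      case False
      have "almost_complete (rel ?F) (?U - {l})"
        by (rule almost_complete_cong_subset[OF ac]) auto
      moreover have "\<not> rel ?F k x" if "x \<in> ?U - {l}" for x
        using centre[OF \<open>Q F\<close>, of x] that False by simp
      ultimately show ?thesis
        by (intro ramsey_graph.almost_complete_if_centre_blue[OF graph[OF F'] U])
    qed
    then show ?thesis using F' unfolding Q_def by blast
  qed
  have "Q F" using F ac unfolding Q_def by blast
  obtain d where d: "d \<in> ?U"
    using U(4) by (metis card.empty equals0I not_numeral_le_zero)
  \<comment> \<open>The Hamiltonian path supplies a red edge, from \<open>d\<close> to
    \<open>hd xs\<close>.\<close>
  obtain xs where xs: "distinct (d # xs)" "set (d # xs) = ?U" "successively (rel F) (d # xs)"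
    using almost_complete_path_from[OF U(3,4) ac d] by blast
  have "length (d # xs) \<ge> 4"
    using U(4) xs(1,2) by (metis distinct_card)
  then have ne: "xs \<noteq> []" by auto
  then have "hd xs \<in> set xs" by simp
  then have "hd xs \<in> ?U - {d}"
    using xs(1) unfolding xs(2)[symmetric] by auto
  moreover have "rel F d (hd xs)"
    using xs(3) ne by (simp add: successively_Cons)
  ultimately have j: "hd xs \<in> ?U - {d}" "rel F d (hd xs)" by blast+
  have bounds: "k \<le> n" "d \<le> n" "k \<noteq> d"
    using d assms(3) by auto
  have "\<exists>G. Q G \<and> G k = F d \<and> (\<forall>j. j \<noteq> k \<longrightarrow> j \<noteq> d \<longrightarrow> G j = F j)"
  proof (rule sliding_blocks[where Q = Q, OF fin card_V])
    show "blocks V s n G" if "Q G" for G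
      using that unfolding Q_def by blast
    show "Q (G(l := insert u (G l - {a})))"
      if "Q G" "l \<le> n" "a \<in> G l" "u \<in> V - (\<Union>i\<le>n. G i)" for G l a u
      using that by (rule step)
    show "k \<le> n" "d \<le> n" "k \<noteq> d"
      using bounds by auto
    show "F d \<subseteq> V" "card (F d) = s"
      using F bounds unfolding blocks_def by blast+
    show "F j \<inter> F d = {}" if "j \<le> n" "j \<noteq> d" for j
      using F bounds that unfolding blocks_def by blast
    show "Q F" by fact
  qed
  then obtain G where G: "Q G" "G k = F d" "\<forall>j. j \<noteq> k \<longrightarrow> j \<noteq> d \<longrightarrow> G j = F j"
    by blast
  moreover from this have "G (hd xs) = F (hd xs)"
    using j(1) by blast
  moreover have "\<not> rel G k (hd xs)"
    using j(1) by (intro centre[OF \<open>Q G\<close>]) blast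
  ultimately show False
    using j(2) by simp
qed

lemma no_blue_star:
  assumes F: "blocks V s n F" and "k \<le> n" and "\<And>x. x \<in> {..n} - {k} \<Longrightarrow> \<not> rel F k x"
  shows False
proof -
  have "almost_complete (rel F) ({..n} - {k})"
  \<comment> \<open>With \<open>w\<close> taken to be \<open>k\<close>, which is outside
    \<open>U\<close>, there is no exceptional vertex and \<open>old\<close> is vacuous.\<close>
  proof (rule ramsey_graph.almost_complete_if_centre_blue[OF graph[OF F]])
    show "{..n} = insert k ({..n} - {k})" using \<open>k \<le> n\<close> by auto
    show "\<not> rel F k x" if "x \<in> {..n} - {k} - {k}" for x using assms(3)[of x] that by blast
  qed (use \<open>k \<le> n\<close> n4 in auto)
  then show False using no_almost_complete F \<open>k \<le> n\<close> by blast
qed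

text \<open>The clique survives every exchange and is joined in red to the two outer blocks. Sliding
  the contents of a clique block \<open>d\<close> into the outer position \<open>x\<close>, with
  another clique block \<open>j\<close> fixed, makes a blue edge red.\<close>

lemma no_blue_K4:
  assumes F: "blocks V s n F" and "n = 5" and U: "U \<subseteq> {..n}" "card U = 4"
    and blue: "pairwise (\<lambda>i j. \<not> rel F i j) U"
  shows False
proof -
  define Q where "Q F \<longleftrightarrow> blocks V s n F \<and> pairwise (\<lambda>i j. \<not> rel F i j) U" for F
  have "card ({..n} - U) = 2"
    using U \<open>n = 5\<close> by (simp add: card_Diff_subset finite_subset)
  then obtain x y where "{..n} - U = {x, y}" "x \<noteq> y" by (auto simp: card_2_iff)
  then have W: "{..n} = insert x (insert y U)" "x \<notin> U" "y \<notin> U" "x \<noteq> y"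
    using U by auto
  have red: "rel F z a" if "Q F" "z \<in> {..n} - U" "a \<in> U" for F z a
  proof -
    have F: "blocks V s n F" and blue: "pairwise (\<lambda>i j. \<not> rel F i j) U"
      using \<open>Q F\<close> unfolding Q_def by (rule conjunct1, rule conjunct2)
    show ?thesis
      by (rule ramsey_graph.red_to_blue_K4[OF graph[OF F] U blue that(2,3)])
  qed
  have step: "Q (F(l := insert u (F l - {a})))"
    if "Q F" "l \<le> n" "a \<in> F l" "u \<in> V - (\<Union>i\<le>n. F i)" for F l a u
  proof -
    let ?F = "F(l := insert u (F l - {a}))"
    have F: "blocks V s n F" and blue: "pairwise (\<lambda>i j. \<not> rel F i j) U"
      using \<open>Q F\<close> unfolding Q_def by (rule conjunct1, rule conjunct2)
    note F' = blocks_replace[OF F fin that(2-4)]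
    have blue': "pairwise (\<lambda>i j. \<not> rel ?F i j) (U - {l})"
      using blue by (auto simp: pairwise_def)
    have "pairwise (\<lambda>i j. \<not> rel ?F i j) U"
    proof (cases "l \<in> U")
      case False
      then show ?thesis using blue' by simp
    next
      case True
      have "rel ?F x i \<and> rel ?F y i" if "i \<in> U - {l}" for i
        using red[OF \<open>Q F\<close>, of x i] red[OF \<open>Q F\<close>, of y i] that W True by auto
      then show ?thesis
        by (rule ramsey_graph.blue_K4_restore[OF graph[OF F'] W U(2) True blue'])
    qed
    then show ?thesis using F' unfolding Q_def by blast
  qed
  have "Q F" using F blue unfolding Q_def by blast
  obtain d where d: "d \<in> U"
    using U(2) by (metis card.empty equals0I zero_neq_numeral)
  have "card (U - {d}) = 3" using U d by (simp add: card_Diff_singleton)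
  then obtain j where j: "j \<in> U" "j \<noteq> d" by (metis DiffE equals0I card.empty singletonI zero_neq_numeral)
  have bounds: "x \<le> n" "d \<le> n" "x \<noteq> d"
    using d U W by auto
  have "\<exists>G. Q G \<and> G x = F d \<and> (\<forall>j. j \<noteq> x \<longrightarrow> j \<noteq> d \<longrightarrow> G j = F j)"
  proof (rule sliding_blocks[where Q = Q, OF fin card_V])
    show "blocks V s n G" if "Q G" for G
      using that unfolding Q_def by blast
    show "Q (G(l := insert u (G l - {a})))"
      if "Q G" "l \<le> n" "a \<in> G l" "u \<in> V - (\<Union>i\<le>n. G i)" for G l a u
      using that by (rule step)
    show "x \<le> n" "d \<le> n" "x \<noteq> d"
      using bounds by auto
    show "F d \<subseteq> V" "card (F d) = s"
      using F bounds unfolding blocks_def by blast+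
    show "F j \<inter> F d = {}" if "j \<le> n" "j \<noteq> d" for j
      using F bounds that unfolding blocks_def by blast
    show "Q F" by fact
  qed
  then obtain G where G: "Q G" "G x = F d" "\<forall>j. j \<noteq> x \<longrightarrow> j \<noteq> d \<longrightarrow> G j = F j"
    by blast
  moreover from this have "G j = F j"
    using j W(2) by metis
  moreover have "rel G x j"
    using j(1) W(2) bounds(1) by (intro red[OF \<open>Q G\<close>]) simp_all
  ultimately have "rel F d j"
    by simp
  then show False
    using pairwiseD[OF blue d j(1)] j(2) by blast
qed

end

section \<open>The upper bound on blocks, by induction on the length of the red path\<close>

text \<open>For \<open>n = 4\<close> the colours are interchangeable and a monochromatic star is
  excluded in both. In the step, a shorter red path and one new block fall under
  \<open>extend_path\<close>, whose two outcomes are excluded patterns.\<close>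

lemma ramsey_upper:
  assumes "n \<ge> 4" "finite V" "card V \<ge> (n + 1) * s + 1"
  shows "(\<exists>F. blocks V s n F \<and> (\<forall>i<n. R (F i \<union> F (Suc i)))) \<or>
    (\<exists>F. blocks V s 4 F \<and> (\<forall>i<4. \<not> R (F i \<union> F (Suc i))))"
  using assms(1,3)
proof (induction n rule: dec_induct)
  case base
  show ?case
  proof (rule ccontr)
    assume neg: "\<not> ?thesis"
    then interpret red: ramsey_free s 4 V R
      using base assms(2) by unfold_locales auto
    interpret blue: ramsey_free s 4 V "\<lambda>e. \<not> R e"
      using neg base assms(2) by unfold_locales auto
    obtain F where F: "blocks V s 4 F"
      using blocks_exist[OF assms(2), of 4 s] base by auto
    obtain k where "k \<in> {..4}"
      "(\<forall>x\<in>{..4} - {k}. red.rel F k x) \<or> (\<forall>x\<in>{..4} - {k}. \<not> red.rel F k x)"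
      using ramsey_graph_monochromatic_star[OF red.graph[OF F] blue.graph[OF F]] by auto
    then show False
      using red.no_blue_star[OF F, of k] blue.no_blue_star[OF F, of k] by auto
  qed
next
  case (step n)
  show ?case
  proof (rule ccontr)
    assume neg: "\<not> ?thesis"
    then interpret ramsey_free s "Suc n" V R
      using step assms(2) by unfold_locales auto
    \<comment> \<open>The blue alternative of the induction hypothesis contradicts
      \<open>neg\<close>.\<close>
    obtain F0 where F0: "blocks V s n F0" "\<forall>i<n. R (F0 i \<union> F0 (Suc i))"
      using step neg by auto
    obtain B where B: "blocks V s (Suc n) (F0(Suc n := B))"
      using blocks_extend[OF F0(1) assms(2)] step.prems by auto
    define F where "F = F0(Suc n := B)"
    note F = B[folded F_def]
    let ?p = "[0..<Suc n]"
    have "successively (rel F) ?p"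
      using F0(2) by (auto simp: successively_conv_nth F_def simp del: upt_Suc)
    moreover have "{..Suc n} = insert (Suc n) (set ?p)" "Suc n \<notin> set ?p" "distinct ?p" "5 \<le> length ?p"
      using step.hyps by auto
    ultimately consider "\<forall>x\<in>set ?p. \<not> rel F (Suc n) x"
      | "length ?p = 5" "pairwise (\<lambda>x y. \<not> rel F x y) {Suc n, ?p ! 0, ?p ! 2, ?p ! 4}"
      using ramsey_graph.extend_path[OF graph[OF F]] by blast
    then show False
    proof cases
      case 1
      then have "\<not> rel F (Suc n) x" if "x \<in> {..Suc n} - {Suc n}" for x
        using that by (simp del: upt_Suc)
      then show False
        using no_blue_star[OF F, of "Suc n"] by blast
    next
      case 2
      \<comment> \<open>The refuted length is \<open>Suc n = 5\<close>, so there are the six blocks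
        that \<open>no_blue_K4\<close> requires.\<close>
      then have n: "n = 4" by simp
      have "?p ! 0 = 0" "?p ! 2 = 2" "?p ! 4 = 4"
        using n by (auto simp del: upt_Suc)
      with 2 have "pairwise (\<lambda>x y. \<not> rel F x y) {5, 0, 2, 4}"
        using n by (simp add: numeral_2_eq_2)
      then show False
        using no_blue_K4[OF F, of "{5, 0, 2, 4}"] n by simp
    qed
  qed
qed

section \<open>From families of blocks to copies of the path\<close>

lemma div_eq_iff_mem_interval:
  fixes s i x :: nat
  assumes "s \<ge> 1"
  shows "x \<in> {1 + i * s..(i + 1) * s} \<longleftrightarrow> x \<ge> 1 \<and> (x - 1) div s = i"
proof (cases x)
  case (Suc y)
  have "y div s = i \<longleftrightarrow> i \<le> y div s \<and> y div s < Suc i" by auto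
  also have "\<dots> \<longleftrightarrow> i * s \<le> y \<and> y < Suc i * s"
    using assms by (simp add: less_eq_div_iff_mult_less_eq div_less_iff_less_mult)
  finally show ?thesis using Suc by (auto simp: algebra_simps)
qed simp

lemma contains_copy_path_iff:
  "contains_copy (colour_class c k (complete_hypergraph r N)) (path_hypergraph s m) \<longleftrightarrow>
    (\<exists>f. inj_on f {1..(m + 1) * s} \<and> f ` {1..(m + 1) * s} \<subseteq> {..<N} \<and>
      (\<forall>i<m. f ` {1 + i * s..(i + 2) * s} \<in> nsets {..<N} r \<and> c (f ` {1 + i * s..(i + 2) * s}) = k))"
proof -
  have "(\<forall>e\<in>{{1 + i * s..(i + 2) * s} |i. i < m}. P e) \<longleftrightarrow> (\<forall>i<m. P {1 + i * s..(i + 2) * s})" for P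
    by blast
  then show ?thesis
    unfolding contains_copy_def colour_class_def complete_hypergraph_def path_hypergraph_def
    by (simp only: hypergraph.select_convs mem_Collect_eq)
qed

text \<open>Bijections from the intervals \<open>I i\<close> onto the blocks glue to an embedding,
  because both families are disjoint.\<close>

lemma contains_path_if_blocks:
  assumes "s \<ge> 1" and F: "blocks {..<N} s m F" and col: "\<And>i. i < m \<Longrightarrow> c (F i \<union> F (Suc i)) = k"
  shows "contains_copy (colour_class c k (complete_hypergraph (2 * s) N)) (path_hypergraph s m)"
proof -
  define I where "I i = {1 + i * s..(i + 1) * s}" for i
  note mem_I = div_eq_iff_mem_interval[OF \<open>s \<ge> 1\<close>, folded I_def]
  have "\<exists>g. bij_betw g (I i) (F i)" if "i \<le> m" for i
    using F that unfolding blocks_def I_def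
    by (intro finite_same_card_bij) (auto intro: finite_subset)
  then obtain g where g: "\<And>i. i \<le> m \<Longrightarrow> bij_betw (g i) (I i) (F i)" by metis
  \<comment> \<open>Path vertices start at 1, so \<open>x\<close> belongs to interval number
    \<open>(x - 1) div s\<close>.\<close>
  define f where "f x = g ((x - 1) div s) x" for x
  have f: "bij_betw f (I i) (F i)" if "i \<le> m" for i
    using g[OF that] by (rule bij_betw_cong[THEN iffD1, rotated]) (simp add: f_def mem_I)
  have V: "{1..(m + 1) * s} = (\<Union>i\<le>m. I i)"
  proof -
    have "x \<in> {1..(m + 1) * s} \<longleftrightarrow> (\<exists>i\<le>m. x \<in> I i)" for x
      using \<open>s \<ge> 1\<close> by (auto simp: mem_I less_Suc_eq_le[symmetric] div_less_iff_less_mult algebra_simps)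
    then show ?thesis by blast
  qed
  have E: "{1 + i * s..(i + 2) * s} = I i \<union> I (Suc i)" for i
    unfolding I_def by auto
  have inj: "inj_on f ({1..(m + 1) * s})"
  proof (rule inj_onI)
    fix x y assume "x \<in> {1..(m + 1) * s}" "y \<in> {1..(m + 1) * s}" "f x = f y"
    then obtain i j where ij: "i \<le> m" "j \<le> m" "x \<in> I i" "y \<in> I j" unfolding V by auto
    then have "f x \<in> F i \<inter> F j" using f \<open>f x = f y\<close> by (metis IntI bij_betwE)
    then have "i = j" using F ij unfolding blocks_def by blast
    then show "x = y" using f[of i] ij \<open>f x = f y\<close> by (auto simp: bij_betw_def inj_on_def)
  qed
  have image: "f ` I i = F i" if "i \<le> m" for i
    using f[OF that] by (simp add: bij_betw_def)
  have sub: "F i \<subseteq> {..<N}" "card (F i) = s" if "i \<le> m" for i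
    using F that unfolding blocks_def by auto
  have "f ` (I i \<union> I (Suc i)) \<in> nsets {..<N} (2 * s) \<and> c (f ` (I i \<union> I (Suc i))) = k" if "i < m" for i
  proof -
    have "f ` (I i \<union> I (Suc i)) = F i \<union> F (Suc i)"
      using image that by (simp add: image_Un)
    moreover have "F i \<inter> F (Suc i) = {}" "finite (F i)" "finite (F (Suc i))"
      using F that finite_subset[OF sub(1)] unfolding blocks_def by auto
    then have "card (F i \<union> F (Suc i)) = 2 * s"
      using that sub by (simp add: card_Un_disjoint)
    ultimately show ?thesis
      using col[OF that] sub[of i] sub[of "Suc i"] that \<open>finite (F i)\<close> \<open>finite (F (Suc i))\<close>
      by (auto simp: nsets_def)
  qed
  moreover have "f ` {1..(m + 1) * s} \<subseteq> {..<N}"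
    unfolding V using image sub by blast
  ultimately show ?thesis
    unfolding contains_copy_path_iff E using inj by blast
qed

section \<open>The lower bound and the Ramsey number\<close>

lemma ramsey_lower:
  assumes "s \<ge> 1" "n \<ge> 4" "N \<le> (n + 1) * s"
  defines "c \<equiv> \<lambda>e. if (0::nat) \<in> e then Blue else Red"
  shows "\<not> contains_copy (colour_class c Red (complete_hypergraph (2 * s) N)) (path_hypergraph s n)"
    and "\<not> contains_copy (colour_class c Blue (complete_hypergraph (2 * s) N)) (path_hypergraph s 4)"
proof -
  show "\<not> contains_copy (colour_class c Red (complete_hypergraph (2 * s) N)) (path_hypergraph s n)"
  proof
    assume "contains_copy (colour_class c Red (complete_hypergraph (2 * s) N)) (path_hypergraph s n)"
    then obtain f where f: "inj_on f {1..(n + 1) * s}" "f ` {1..(n + 1) * s} \<subseteq> {..<N}"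
      and red: "\<And>i. i < n \<Longrightarrow> c (f ` {1 + i * s..(i + 2) * s}) = Red"
      unfolding contains_copy_path_iff by blast
    \<comment> \<open>As \<open>N\<close> is at most the number of path vertices, the copy is
      spanning and must use the vertex 0.\<close>
    have "f ` {1..(n + 1) * s} = {..<N}"
      using f assms(3) by (intro card_seteq) (simp_all add: card_image)
    moreover have "N > 0"
      using calculation assms(1) by (cases N) auto
    ultimately obtain x where x: "x \<in> {1..(n + 1) * s}" "f x = 0" by (metis imageE lessThan_iff)
    \<comment> \<open>The edge starting with the interval of \<open>x\<close> contains
      \<open>x\<close>; the minimum handles the last interval, which starts no edge but lies in edge
      \<open>n - 1\<close>.\<close>
    define i where "i = min ((x - 1) div s) (n - 1)"
    have "x \<in> {1 + i * s..(i + 2) * s}"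
    proof (cases "(x - 1) div s \<le> n - 1")
      case True
      then have "x \<in> {1 + i * s..(i + 1) * s}"
        using x assms(1) div_eq_iff_mem_interval[of s x i] by (simp add: i_def)
      then show ?thesis by auto
    next
      case False
      then have "i = n - 1" "n \<le> (x - 1) div s" by (auto simp: i_def)
      then have "n * s \<le> x - 1" using assms(1) by (simp add: less_eq_div_iff_mult_less_eq)
      moreover have "i * s \<le> n * s" "i + 2 = n + 1"
        using \<open>i = n - 1\<close> assms(2) by auto
      ultimately have "1 + i * s \<le> x" using x by (simp only: atLeastAtMost_iff) linarith
      then show ?thesis using x \<open>i + 2 = n + 1\<close> by simp
    qed
    then have "0 \<in> f ` {1 + i * s..(i + 2) * s}" using x by (metis imageI)
    moreover have "i < n" using assms(2) by (auto simp: i_def)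
    ultimately show False using red[of i] by (simp add: c_def)
  qed
  show "\<not> contains_copy (colour_class c Blue (complete_hypergraph (2 * s) N)) (path_hypergraph s 4)"
  proof
    assume "contains_copy (colour_class c Blue (complete_hypergraph (2 * s) N)) (path_hypergraph s 4)"
    then obtain f where f: "inj_on f {1..(4 + 1) * s}"
      and blue: "\<And>i. i < 4 \<Longrightarrow> c (f ` {1 + i * s..(i + 2) * s}) = Blue"
      unfolding contains_copy_path_iff by blast
    have "0 \<in> f ` {1 + i * s..(i + 2) * s}" if "i < 4" for i
      using blue[OF that] by (auto simp: c_def split: if_splits)
    \<comment> \<open>Edges 0 and 2 are disjoint, so by injectivity their images cannot share the
      vertex 0.\<close>
    from this[of 0] this[of 2] have "0 \<in> f ` {1..2 * s}" "0 \<in> f ` {1 + 2 * s..4 * s}"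
      by (simp_all add: mult_2)
    then obtain x y
      where "x \<in> {1..2 * s}" "y \<in> {1 + 2 * s..4 * s}" "f x = 0" "f y = 0"
      by (metis imageE)
    moreover from this have "x = y"
      using inj_onD[OF f, of x y] by auto
    ultimately show False by auto
  qed
qed

theorem theorem2:
  fixes s n :: nat
  assumes "s \<ge> 1" and "n \<ge> 4"
  shows "ramsey_number (2 * s) (path_hypergraph s n) (path_hypergraph s 4) = (n + 1) * s + 1"
  unfolding ramsey_number_def
proof (rule Least_equality)
  let ?N = "(n + 1) * s + 1"
  show "\<forall>c. contains_copy (colour_class c Red (complete_hypergraph (2 * s) ?N)) (path_hypergraph s n) \<or>
    contains_copy (colour_class c Blue (complete_hypergraph (2 * s) ?N)) (path_hypergraph s 4)"
  proof
    fix c :: "nat set \<Rightarrow> colour"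
    have "c e = Blue" if "c e \<noteq> Red" for e using that by (cases "c e") auto
    then show "contains_copy (colour_class c Red (complete_hypergraph (2 * s) ?N)) (path_hypergraph s n) \<or>
      contains_copy (colour_class c Blue (complete_hypergraph (2 * s) ?N)) (path_hypergraph s 4)"
      using ramsey_upper[of n "{..<?N}" s "\<lambda>e. c e = Red"] assms contains_path_if_blocks[OF assms(1)]
      by (metis card_lessThan finite_lessThan order_refl)
  qed
next
  fix N
  assume N: "\<forall>c. contains_copy (colour_class c Red (complete_hypergraph (2 * s) N)) (path_hypergraph s n) \<or>
    contains_copy (colour_class c Blue (complete_hypergraph (2 * s) N)) (path_hypergraph s 4)"
  show "(n + 1) * s + 1 \<le> N"
  proof (rule ccontr)
    assume "\<not> (n + 1) * s + 1 \<le> N"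
    then have "N \<le> (n + 1) * s" by simp
    from ramsey_lower[OF assms this] N show False by blast
  qed
qed

end
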